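(* Let $k=k(n)\in\{1,\dots,n\}$. Suppose $k=o((n/\log n)^{1/2})$ and also $k\to\infty$ as $n\to\infty$. Then the top-to-random transposition shuffle has $k$-partial cutoff at time $n\log k$ with a window of size $O(n)$. Furthermore, if instead there is a constant $K$ such that $k<K$ for all $n$, then there is no cutoff, i.e. the top-to-random transposition shuffle does not have $k$-partial cutoff (at any time with any window).
   Context: Notation: $[n]=\{1,\dots,n\}$. A permutation $\sigma\in S_n$ is an arrangement of $n$ labelled cards in locations $1,\dots,n$ of a deck; $\sigma^{-1}(i)$ is the location of the card with label $i$. Top-to-random transposition shuffle: at each step $t=1,2,\dots$ the left hand chooses location $L_t=1$, the right hand chooses a location $R_t$ uniform on $[n]$, independently of all past choices, and the cards in locations $L_t$ and $R_t$ are swapped (nothing changes if $L_t=R_t$). $\sigma_t$ denotes the permutation at time $t$ started at time $0$ from $\sigma_0$, and $\pi$ a uniform random permutation. For distinct cards $c_1,\dots,c_k\in[n]$, $\mu^{\sigma}_{c_1,\dots,c_k}$ denotes the joint law of the locations $(\sigma^{-1}(c_1),\dots,\sigma^{-1}(c_k))$ in a random permutation $\sigma$. Define $$d_{c_1,\dots,c_k}(t)=\max_{\sigma_0\in S_n}\|\mu^{\sigma_t}_{c_1,\dots,c_k}-\mu^{\pi}_{c_1,\dots,c_k}\|_{\mathrm{TV}},$$ where $\|\cdot\|_{\mathrm{TV}}$ is total variation distance; at a non-integer time $t\geq 0$ this is read at time $\lfloor t\rfloor$. Let $\Omega_k$ be the set of all subsets of $[n]$ of size $k$. $k$-partial cutoff: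 a shuffle (given for each $n$) has $k$-partial cutoff at time $t_{\mathrm{mix}}=t_{\mathrm{mix}}(n)$ with a window of size $\omega(n)=o(t_{\mathrm{mix}})$ (with $\omega(n)>0$) if (i) $\lim_{\alpha\to\infty}\limsup_{n\to\infty}\max_{\{c_1,\dots,c_k\}\in\Omega_k}d_{c_1,\dots,c_k}(t_{\mathrm{mix}}+\alpha\,\omega(n))=0$, and (ii) $\lim_{\alpha\to-\infty}\liminf_{n\to\infty}\max_{\{c_1,\dots,c_k\}\in\Omega_k}d_{c_1,\dots,c_k}(t_{\mathrm{mix}}+\alpha\,\omega(n))=1$. "With a window of size $O(n)$" means that this holds for some window $\omega(n)$ with $\omega(n)=O(n)$. *)

theory Defs
  imports
    "HOL-Probability.Probability"
    "HOL-Combinatorics.Permutations"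
    "HOL-Library.Landau_Symbols"
begin

(* A deck of n cards is a permutation s of {1..n}: s j is the label of the card in location j,
   so inv s i is the location of the card labelled i. *)
definition decks :: "nat \<Rightarrow> (nat \<Rightarrow> nat) set" where
  "decks n = {\<sigma>. \<sigma> permutes {1..n}}"

(* A shuffle is given, for each n, by its one-step transition kernel. *)
type_synonym shuffle = "nat \<Rightarrow> (nat \<Rightarrow> nat) \<Rightarrow> (nat \<Rightarrow> nat) pmf"

primrec shuffle_law :: "shuffle \<Rightarrow> nat \<Rightarrow> (nat \<Rightarrow> nat) \<Rightarrow> nat \<Rightarrow> (nat \<Rightarrow> nat) pmf" where
  "shuffle_law P n \<sigma>\<^sub>0 0 = return_pmf \<sigma>\<^sub>0"
| "shuffle_law P n \<sigma>\<^sub>0 (Suc t) = bind_pmf (shuffle_law P n \<sigma>\<^sub>0 t) (P n)"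

(* Right-composition with a transposition exchanges the cards in the two given locations.
   The name is qualified because HOL-Analysis also has a transpose for matrices. *)
definition top_to_random_transposition :: shuffle where
  "top_to_random_transposition n \<sigma> =
     map_pmf (\<lambda>R. \<sigma> \<circ> Transposition.transpose 1 R) (pmf_of_set {1..n})"

definition locations_law :: "nat list \<Rightarrow> (nat \<Rightarrow> nat) pmf \<Rightarrow> nat list pmf" where
  "locations_law cs p = map_pmf (\<lambda>\<sigma>. map (inv \<sigma>) cs) p"

definition tv_dist :: "'a pmf \<Rightarrow> 'a pmf \<Rightarrow> real" where
  "tv_dist p q = (SUP A. \<bar>measure_pmf.prob p A - measure_pmf.prob q A\<bar>)"

(* A real time t is read at its floor; nat sends negative values to time 0. *)
definition partial_dist :: "shuffle \<Rightarrow> nat \<Rightarrow> nat list \<Rightarrow> real \<Rightarrow> real" where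
  "partial_dist P n cs t =
     (MAX \<sigma>\<^sub>0\<in>decks n.
        tv_dist (locations_law cs (shuffle_law P n \<sigma>\<^sub>0 (nat \<lfloor>t\<rfloor>)))
                (locations_law cs (pmf_of_set (decks n))))"

(* The total variation distance does not depend on the order in which the cards of C are listed,
   so each C is listed increasingly. *)
definition max_partial_dist :: "shuffle \<Rightarrow> nat \<Rightarrow> nat \<Rightarrow> real \<Rightarrow> real" where
  "max_partial_dist P n k t =
     (MAX C\<in>{C. C \<subseteq> {1..n} \<and> card C = k}. partial_dist P n (sorted_list_of_set C) t)"

(* Since w = o(tmix), the argument tmix n + a * w n has the sign of tmix n for all large n. *)
definition has_partial_cutoff ::
    "shuffle \<Rightarrow> (nat \<Rightarrow> nat) \<Rightarrow> (nat \<Rightarrow> real) \<Rightarrow> (nat \<Rightarrow> real) \<Rightarrow> bool" where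
  "has_partial_cutoff P k tmix w \<longleftrightarrow>
     (\<forall>n\<ge>1. w n > 0) \<and> w \<in> o(tmix) \<and>
     ((\<lambda>\<alpha>::real. limsup (\<lambda>n. ereal (max_partial_dist P n (k n) (tmix n + \<alpha> * w n))))
        \<longlongrightarrow> 0) at_top \<and>
     ((\<lambda>\<alpha>::real. liminf (\<lambda>n. ereal (max_partial_dist P n (k n) (tmix n + \<alpha> * w n))))
        \<longlongrightarrow> 1) at_bot"

end

theory Submission
  imports Defs "HOL-Real_Asymp.Real_Asymp"
begin

text \<open>Only the locations \<open>x = inv \<sigma>\<close> of the tracked cards matter, and one step replaces \<open>x\<close> by
  \<open>transpose 1 R \<circ> x\<close>.

  Upper bound: the total variation distance between the laws started from two placements that differ
  in the location of a single card shrinks by a factor \<open>1 - 1/n + O(k/n\<^sup>2)\<close> in each step, as is seen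
  from a coupling of a single step. Changing one card at a time gives
  \<open>d t \<le> 4 k (1 - 1/n + O(k/n\<^sup>2)) ^ t\<close>.

  Lower bound: track \<open>k\<close> cards that start at locations other than the top. The number of their
  locations that are not chosen up to time \<open>t\<close> is the number of missing coupons, whose second moment
  shows that it is positive with probability at least \<open>1 - 1 / (k (1 - 1/n) ^ t)\<close>. In a uniform deck
  some tracked card is at its original location with probability at most \<open>k / n\<close>.\<close>

section \<open>The shuffle as an averaging operator on functions of card locations\<close>

definition swap_avg :: "nat \<Rightarrow> ((nat \<Rightarrow> nat) \<Rightarrow> real) \<Rightarrow> (nat \<Rightarrow> nat) \<Rightarrow> real" where
  "swap_avg n f x = (\<Sum>R=1..n. f (Transposition.transpose 1 R \<circ> x)) / real n"

lemma finite_decks: "finite (decks n)"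
  by (simp add: decks_def finite_permutations)

lemma id_in_decks: "id \<in> decks n"
  by (simp add: decks_def permutes_id)

lemma decks_step:
  assumes "\<sigma> \<in> decks n" "R \<in> {1..n}"
  shows "\<sigma> \<circ> Transposition.transpose 1 R \<in> decks n"
  using assms by (auto simp: decks_def intro!: permutes_compose permutes_swap_id)

lemma set_pmf_shuffle_law:
  assumes "n \<ge> 1" "\<sigma>\<^sub>0 \<in> decks n"
  shows "set_pmf (shuffle_law top_to_random_transposition n \<sigma>\<^sub>0 t) \<subseteq> decks n"
proof (induction t)
  case (Suc t)
  then show ?case
    using assms decks_step by (force simp: top_to_random_transposition_def)
qed (use assms in simp)

lemma inv_comp_transpose:
  assumes "\<sigma> \<in> decks n"
  shows "inv (\<sigma> \<circ> Transposition.transpose a b) = Transposition.transpose a b \<circ> inv \<sigma>"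
  using assms by (subst o_inv_distrib) (auto simp: decks_def permutes_bij)

lemma expectation_step:
  assumes "n \<ge> 1" "\<sigma> \<in> decks n"
  shows "measure_pmf.expectation (top_to_random_transposition n \<sigma>) (\<lambda>\<sigma>. f (inv \<sigma>))
    = swap_avg n f (inv \<sigma>)"
  using assms
  by (simp add: top_to_random_transposition_def integral_pmf_of_set swap_avg_def
      inv_comp_transpose[OF assms(2)])

text \<open>Averaging out the last step turns the test function \<open>f\<close> into
  \<open>swap_avg n f\<close>, and the induction hypothesis for that new function handles the
  remaining steps; hence \<open>f\<close> is arbitrary in the induction. Probabilities after
  \<open>t\<close> steps thereby become values of one iterated function at the starting placement,
  so that different starting decks can be compared directly.\<close>

lemma expectation_shuffle_law:
  assumes n: "n \<ge> 1" and \<sigma>0: "\<sigma>\<^sub>0 \<in> decks n"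
  shows "measure_pmf.expectation (shuffle_law top_to_random_transposition n \<sigma>\<^sub>0 t) (\<lambda>\<sigma>. f (inv \<sigma>))
    = (swap_avg n ^^ t) f (inv \<sigma>\<^sub>0)"
proof (induction t arbitrary: f)
  case (Suc t)
  let ?p = "shuffle_law top_to_random_transposition n \<sigma>\<^sub>0 t"
  have fin: "finite (set_pmf (top_to_random_transposition n \<sigma>))" for \<sigma>
    using n by (simp add: top_to_random_transposition_def)
  have "measure_pmf.expectation (shuffle_law top_to_random_transposition n \<sigma>\<^sub>0 (Suc t)) (\<lambda>\<sigma>. f (inv \<sigma>))
    = (\<Sum>\<sigma>\<in>decks n. pmf ?p \<sigma> *\<^sub>R measure_pmf.expectation (top_to_random_transposition n \<sigma>) (\<lambda>\<sigma>. f (inv \<sigma>)))"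
    using set_pmf_shuffle_law[OF n \<sigma>0] fin
    by (simp add: pmf_expectation_bind[where A = "decks n"] finite_decks)
  also have "\<dots> = (\<Sum>\<sigma>\<in>decks n. pmf ?p \<sigma> *\<^sub>R swap_avg n f (inv \<sigma>))"
    using n by (intro sum.cong refl) (simp add: expectation_step)
  also have "\<dots> = measure_pmf.expectation ?p (\<lambda>\<sigma>. swap_avg n f (inv \<sigma>))"
    using set_pmf_shuffle_law[OF n \<sigma>0, of t]
    by (subst integral_measure_pmf[OF finite_decks[of n]]) auto
  finally show ?case
    by (simp add: Suc.IH funpow_swap1)
qed simp

lemma prob_locations_law:
  "measure_pmf.prob (locations_law cs p) A
    = measure_pmf.expectation p (\<lambda>\<sigma>. indicator A (map (inv \<sigma>) cs))"
proof -
  have "(\<lambda>\<sigma>. indicator A (map (inv \<sigma>) cs)) = (indicator ((\<lambda>\<sigma>. map (inv \<sigma>) cs) -` A) :: _ \<Rightarrow> real)"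
    by (auto simp: indicator_def fun_eq_iff)
  then show ?thesis by (simp add: locations_law_def)
qed

text \<open>This is stationarity of the uniform law: right composition with a fixed transposition is
  an involution of the set of decks.\<close>

lemma sum_swap_avg_decks:
  assumes "n \<ge> 1"
  shows "(\<Sum>\<sigma>\<in>decks n. swap_avg n f (inv \<sigma>)) = (\<Sum>\<sigma>\<in>decks n. f (inv \<sigma>))"
proof -
  have "(\<Sum>\<sigma>\<in>decks n. f (Transposition.transpose 1 R \<circ> inv \<sigma>)) = (\<Sum>\<sigma>\<in>decks n. f (inv \<sigma>))"
    if "R \<in> {1..n}" for R
  proof -
    have "(\<Sum>\<sigma>\<in>decks n. f (inv \<sigma>)) = (\<Sum>\<sigma>\<in>decks n. f (inv (\<sigma> \<circ> Transposition.transpose 1 R)))"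
      by (rule sum.reindex_bij_witness[where i = "\<lambda>\<sigma>. \<sigma> \<circ> Transposition.transpose 1 R"
            and j = "\<lambda>\<sigma>. \<sigma> \<circ> Transposition.transpose 1 R"])
        (use decks_step that in \<open>auto simp: comp_assoc\<close>)
    then show ?thesis by (simp add: inv_comp_transpose)
  qed
  then have "(\<Sum>R=1..n. \<Sum>\<sigma>\<in>decks n. f (Transposition.transpose 1 R \<circ> inv \<sigma>))
      = real n * (\<Sum>\<sigma>\<in>decks n. f (inv \<sigma>))"
    by simp
  then show ?thesis
    using assms by (simp add: swap_avg_def sum_divide_distrib[symmetric] sum.swap[of _ "decks n"])
qed

lemma sum_funpow_swap_avg_decks:
  assumes "n \<ge> 1"
  shows "(\<Sum>\<sigma>\<in>decks n. (swap_avg n ^^ t) f (inv \<sigma>)) = (\<Sum>\<sigma>\<in>decks n. f (inv \<sigma>))"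
  by (induction t) (simp_all add: sum_swap_avg_decks[OF assms])

text \<open>A step composes with a transposition on the left, so two functions that agree on
  \<open>C\<close> still agree there afterwards. This lets the iterates be treated as functions of
  the tracked cards alone.\<close>

lemma swap_avg_cong_on:
  assumes "\<And>x y. \<forall>c\<in>C. x c = y c \<Longrightarrow> f x = f y" and "\<forall>c\<in>C. x c = y c"
  shows "(swap_avg n ^^ t) f x = (swap_avg n ^^ t) f y"
  using assms(2)
proof (induction t arbitrary: x y)
  case (Suc t)
  have "(swap_avg n ^^ t) f (Transposition.transpose 1 R \<circ> x)
      = (swap_avg n ^^ t) f (Transposition.transpose 1 R \<circ> y)" for R
    using Suc.prems by (intro Suc.IH) simp
  then show ?case by (simp add: swap_avg_def[of n "(swap_avg n ^^ t) f"])
qed (use assms(1) in auto)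

section \<open>Contraction of discrepancies between placements of the tracked cards\<close>

text \<open>Nothing is demanded outside \<open>C\<close>, so a single tracked card can be relocated
  without completing the result to a permutation.\<close>

definition placement :: "nat \<Rightarrow> nat set \<Rightarrow> (nat \<Rightarrow> nat) \<Rightarrow> bool" where
  "placement n C x \<longleftrightarrow> inj_on x C \<and> x ` C \<subseteq> {1..n}"

lemma placement_transpose:
  assumes "placement n C x" "R \<in> {1..n}"
  shows "placement n C (Transposition.transpose 1 R \<circ> x)"
proof -
  have "inj_on (Transposition.transpose 1 R \<circ> x) C"
    using assms by (intro comp_inj_on inj_on_subset[OF inj_transpose]) (auto simp: placement_def)
  moreover have "(Transposition.transpose 1 R \<circ> x) ` C \<subseteq> {1..n}"
    using assms by (auto simp: placement_def Transposition.transpose_def)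
  ultimately show ?thesis by (simp add: placement_def)
qed

text \<open>The weight \<open>1 + 2 / n\<close> of the pairs with a tracked card on top is chosen so that the weighted
  discrepancy contracts by the same factor from both kinds of pairs. If no tracked card is on top, then the
  choice \<open>R\<close> for \<open>x\<close> is coupled with \<open>R\<close> for \<open>z\<close>, except that \<open>x i\<close> and \<open>z i\<close> are exchanged, so that
  choosing \<open>x i\<close> makes the placements agree. Otherwise both use the same \<open>R\<close>.\<close>

lemma one_card_discrepancy:
  fixes f :: "(nat \<Rightarrow> nat) \<Rightarrow> real"
  assumes f01: "\<And>x. 0 \<le> f x \<and> f x \<le> 1"
    and fC: "\<And>x y. \<forall>c\<in>C. x c = y c \<Longrightarrow> f x = f y"
    and C: "finite C" "card C = k" "k \<ge> 1" and n: "2 * k + 4 \<le> n"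
    and i: "i \<in> C"
    and x: "placement n C x" and z: "placement n C z"
    and xz: "\<forall>c\<in>C - {i}. x c = z c" and ne: "x i \<noteq> z i"
  shows "\<bar>(swap_avg n ^^ t) f x - (swap_avg n ^^ t) f z\<bar>
    \<le> (if 1 \<in> x ` C \<union> z ` C then 1 + 2 / real n else 1)
        * (1 - 1 / real n + 2 * (real k - 1) / (real n)\<^sup>2) ^ t"
  using x z xz ne
proof (induction t arbitrary: x z)
  case 0
  have "\<bar>f x - f z\<bar> \<le> 1" using f01[of x] f01[of z] by linarith
  moreover have "1 \<le> 1 + 2 / real n" by simp
  ultimately have "\<bar>f x - f z\<bar> \<le> 1 + 2 / real n" by linarith
  with \<open>\<bar>f x - f z\<bar> \<le> 1\<close> show ?case by simp
next
  case (Suc t)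
  define g where "g = (swap_avg n ^^ t) f"
  define \<rho> where "\<rho> = 1 - 1 / real n + 2 * (real k - 1) / (real n)\<^sup>2"
  define \<delta> where "\<delta> = 2 / real n"
  have n0: "real n > 0" using n by simp
  have \<rho>0: "\<rho> \<ge> 0" unfolding \<rho>_def
  proof -
    have "1 / real n \<le> 1" using n by simp
    moreover have "2 * (real k - 1) / (real n)\<^sup>2 \<ge> 0" using C by simp
    ultimately show "0 \<le> 1 - 1 / real n + 2 * (real k - 1) / (real n)\<^sup>2" by linarith
  qed
  have \<delta>0: "\<delta> \<ge> 0" by (simp add: \<delta>_def)
  define S where "S = x ` (C - {i})"
  have S': "S = z ` (C - {i})" using Suc.prems(3) by (auto simp: S_def)
  have xC: "x ` C = insert (x i) S" and zC: "z ` C = insert (z i) S"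
    using i by (auto simp: S_def) (use S' S_def in auto)
  have injx: "inj_on x C" and injz: "inj_on z C"
    and rx: "x ` C \<subseteq> {1..n}" and rz: "z ` C \<subseteq> {1..n}"
    using Suc.prems by (auto simp: placement_def)
  have xS: "x i \<notin> S" using injx i by (auto simp: S_def inj_on_def)
  have zS: "z i \<notin> S" using injz i by (auto simp: S' inj_on_def)
  have finS: "finite S" using C by (simp add: S_def)
  have cS: "card S = k - 1"
    using injx i C by (simp add: S_def card_image inj_on_diff)
  have Sn: "S \<subseteq> {1..n}" and xn: "x i \<in> {1..n}" and zn: "z i \<in> {1..n}"
    using rx rz xC zC by auto
  have IH: "\<bar>g x' - g z'\<bar> \<le> (if 1 \<in> x' ` C \<union> z' ` C then 1 + \<delta> else 1) * \<rho> ^ t"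
    if "placement n C x'" "placement n C z'" "\<forall>c\<in>C - {i}. x' c = z' c" "x' i \<noteq> z' i" for x' z'
    using Suc.IH[OF that] by (simp only: g_def \<rho>_def \<delta>_def)
  have IHle: "\<bar>g x' - g z'\<bar> \<le> (1 + \<delta>) * \<rho> ^ t"
    if "placement n C x'" "placement n C z'" "\<forall>c\<in>C - {i}. x' c = z' c" "x' i \<noteq> z' i" for x' z'
    using IH[OF that] \<delta>0 \<rho>0 by (auto split: if_splits simp: algebra_simps intro: order_trans)
  have gC: "g x' = g z'" if "\<forall>c\<in>C. x' c = z' c" for x' z'
    unfolding g_def using fC that by (rule swap_avg_cong_on) auto
  have moved: "Transposition.transpose 1 R (x i) \<noteq> Transposition.transpose 1 R (z i)" for R
    using Suc.prems(4) injD[OF inj_transpose] by metis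
  show ?case
  proof (cases "1 \<in> x ` C \<union> z ` C")
    case False
    then have one: "1 \<noteq> x i" "1 \<noteq> z i" "1 \<notin> S" using xC zC by auto
    define \<phi> where "\<phi> = Transposition.transpose (x i) (z i)"
    \<comment> \<open>Weights after the coupled step. For \<open>R = x i\<close> both copies of card
      \<open>i\<close> land on top and the placements agree; for \<open>R \<in> S\<close> a common
      tracked card comes on top; every other choice moves no tracked card in either
      placement.\<close>
    define b where "b R = (if R = x i then 0 else if R \<in> S then 1 + \<delta> else 1)" for R
    have bound: "\<bar>g (Transposition.transpose 1 R \<circ> x) - g (Transposition.transpose 1 (\<phi> R) \<circ> z)\<bar>
        \<le> b R * \<rho> ^ t" if R: "R \<in> {1..n}" for R
    proof -
      consider "R = x i" | "R \<noteq> x i" "R \<in> S" | "R \<noteq> x i" "R \<notin> S" by blast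
      then show ?thesis
      proof cases
        case 1
        have "\<forall>c\<in>C. (Transposition.transpose 1 R \<circ> x) c = (Transposition.transpose 1 (\<phi> R) \<circ> z) c"
        proof
          fix c assume c: "c \<in> C"
          show "(Transposition.transpose 1 R \<circ> x) c = (Transposition.transpose 1 (\<phi> R) \<circ> z) c"
          proof (cases "c = i")
            case True then show ?thesis using 1 by (simp add: \<phi>_def)
          next
            case False
            then have "x c \<in> S" "z c = x c" using c Suc.prems(3) by (auto simp: S_def)
            then have "x c \<noteq> 1" "x c \<noteq> x i" "z c = x c" "x c \<noteq> z i"
              using one xS zS by auto
            then show ?thesis using 1 by (simp add: \<phi>_def)
          qed
        qed
        then have "g (Transposition.transpose 1 R \<circ> x) = g (Transposition.transpose 1 (\<phi> R) \<circ> z)"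
          by (rule gC)
        then show ?thesis using 1 by (simp add: b_def)
      next
        case 2
        have "\<phi> R = R" using 2 zS by (auto simp: \<phi>_def Transposition.transpose_def)
        then have "\<bar>g (Transposition.transpose 1 R \<circ> x) - g (Transposition.transpose 1 (\<phi> R) \<circ> z)\<bar>
            \<le> (1 + \<delta>) * \<rho> ^ t"
          using R Suc.prems moved by (simp only:) (intro IHle placement_transpose; simp)
        then show ?thesis using 2 by (simp add: b_def)
      next
        case 3
        then have Rx: "R \<notin> x ` C" using xC by simp
        have Rz: "\<phi> R \<notin> z ` C"
          using 3 xS Suc.prems(4) zC by (auto simp: \<phi>_def Transposition.transpose_def)
        have "g (Transposition.transpose 1 R \<circ> x) = g x"
        proof (rule gC, rule ballI)
          fix c assume "c \<in> C"
          then have "x c \<in> x ` C" by (rule imageI)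
          then have "x c \<noteq> 1" "x c \<noteq> R" using Rx False by auto
          then show "(Transposition.transpose 1 R \<circ> x) c = x c" by simp
        qed
        moreover have "g (Transposition.transpose 1 (\<phi> R) \<circ> z) = g z"
        proof (rule gC, rule ballI)
          fix c assume "c \<in> C"
          then have "z c \<in> z ` C" by (rule imageI)
          then have "z c \<noteq> 1" "z c \<noteq> \<phi> R" using Rz False by auto
          then show "(Transposition.transpose 1 (\<phi> R) \<circ> z) c = z c" by simp
        qed
        ultimately show ?thesis
          using IH[OF Suc.prems] False 3 by (simp add: b_def)
      qed
    qed
    have "(\<Sum>R=1..n. g (Transposition.transpose 1 R \<circ> z))
        = (\<Sum>R=1..n. g (Transposition.transpose 1 (\<phi> R) \<circ> z))"
      by (rule sum.reindex_bij_witness[where i = \<phi> and j = \<phi>])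
        (use xn zn in \<open>auto simp: \<phi>_def Transposition.transpose_def\<close>)
    then have "\<bar>swap_avg n g x - swap_avg n g z\<bar>
      = \<bar>\<Sum>R=1..n. g (Transposition.transpose 1 R \<circ> x) - g (Transposition.transpose 1 (\<phi> R) \<circ> z)\<bar> / n"
      by (simp add: swap_avg_def sum_subtractf flip: diff_divide_distrib)
    also have "\<dots> \<le> (\<Sum>R=1..n. b R * \<rho> ^ t) / n"
      by (intro divide_right_mono order_trans[OF sum_abs] sum_mono bound) auto
    also have "(\<Sum>R=1..n. b R * \<rho> ^ t) = (\<Sum>R=1..n. b R) * \<rho> ^ t"
      by (simp add: sum_distrib_right)
    also have "(\<Sum>R=1..n. b R) = (\<Sum>R=1..n. 1 - (if R = x i then 1 else 0) + (if R \<in> S then \<delta> else 0))"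
      using xS by (intro sum.cong) (auto simp: b_def)
    also have "\<dots> = real n - 1 + real (k - 1) * \<delta>"
      using xn Sn finS cS by (simp add: sum.distrib sum_subtractf sum.If_cases Int_absorb1)
    \<comment> \<open>The rate \<open>\<rho>\<close> is the one that makes this case an
      equality.\<close>
    also have "\<dots> = real n * \<rho>"
      using n0 C by (simp add: \<rho>_def \<delta>_def field_simps power2_eq_square)
    finally show ?thesis using False n0 by (simp add: g_def \<rho>_def)
  next
    case True
    \<comment> \<open>The locations occupied in \<open>x\<close> or in \<open>z\<close>. Since
      locations 1 and \<open>R\<close> are exchanged, a tracked card is on top after the step
      exactly when \<open>R \<in> U\<close>.\<close>
    define U where "U = insert (x i) (insert (z i) S)"
    have cU: "card U = k + 1"
      using xS zS Suc.prems(4) finS cS C by (simp add: U_def)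
    define b where "b R = (if R \<in> U then 1 + \<delta> else 1)" for R
    have bound: "\<bar>g (Transposition.transpose 1 R \<circ> x) - g (Transposition.transpose 1 R \<circ> z)\<bar>
        \<le> b R * \<rho> ^ t" if R: "R \<in> {1..n}" for R
    proof -
      let ?x = "Transposition.transpose 1 R \<circ> x" and ?z = "Transposition.transpose 1 R \<circ> z"
      have "\<bar>g ?x - g ?z\<bar> \<le> (if 1 \<in> ?x ` C \<union> ?z ` C then 1 + \<delta> else 1) * \<rho> ^ t"
        using R Suc.prems moved by (intro IH placement_transpose) auto
      moreover have "1 \<in> ?x ` C \<union> ?z ` C \<longleftrightarrow> R \<in> U"
      proof -
        have "U = x ` C \<union> z ` C" using xC zC by (auto simp: U_def)
        moreover have "1 \<in> (Transposition.transpose 1 R \<circ> y) ` C \<longleftrightarrow> R \<in> y ` C" for y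
          using inj_image_mem_iff[OF inj_transpose, of 1 R R "y ` C"] by (simp add: image_comp)
        ultimately show ?thesis by blast
      qed
      ultimately show ?thesis by (simp add: b_def)
    qed
    have "\<bar>swap_avg n g x - swap_avg n g z\<bar>
      = \<bar>\<Sum>R=1..n. g (Transposition.transpose 1 R \<circ> x) - g (Transposition.transpose 1 R \<circ> z)\<bar> / n"
      by (simp add: swap_avg_def sum_subtractf flip: diff_divide_distrib)
    also have "\<dots> \<le> (\<Sum>R=1..n. b R * \<rho> ^ t) / n"
      by (intro divide_right_mono order_trans[OF sum_abs] sum_mono bound) auto
    also have "(\<Sum>R=1..n. b R * \<rho> ^ t) = (\<Sum>R=1..n. b R) * \<rho> ^ t"
      by (simp add: sum_distrib_right)
    also have "(\<Sum>R=1..n. b R) = (\<Sum>R=1..n. 1 + (if R \<in> U then \<delta> else 0))"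
      by (intro sum.cong) (auto simp: b_def)
    also have "\<dots> = real n + real (k + 1) * \<delta>"
    proof -
      have "U \<subseteq> {1..n}" "finite U" using Sn xn zn finS by (auto simp: U_def)
      then show ?thesis using cU by (simp add: sum.distrib sum.If_cases Int_absorb1)
    qed
    \<comment> \<open>As \<open>n * \<rho> \<ge> n - 1\<close>, it suffices that the left side is at
      most \<open>(1 + \<delta>) * (n - 1) = n + 1 - 2 / n\<close>. This amounts to
      \<open>2 * (k + 2) \<le> n\<close>, the size hypothesis.\<close>
    also have "\<dots> \<le> real n * ((1 + \<delta>) * \<rho>)"
    proof -
      have "2 * (real k + 2) / real n \<le> 1" using n n0 by (simp add: field_simps)
      moreover have "real (k + 1) * \<delta> + 2 / real n = 2 * (real k + 2) / real n"
        using n0 by (simp add: \<delta>_def field_simps)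
      ultimately have 1: "real n + real (k + 1) * \<delta> \<le> real n + 1 - 2 / real n"
        by linarith
      have "real n + 1 - 2 / real n = (1 + \<delta>) * (real n - 1)"
        using n0 by (simp add: \<delta>_def field_simps)
      also have "\<dots> \<le> (1 + \<delta>) * (real n * \<rho>)"
      proof (rule mult_left_mono)
        have "real n * \<rho> = real n - 1 + 2 * (real k - 1) / real n"
          using n0 by (simp add: \<rho>_def field_simps power2_eq_square)
        then show "real n - 1 \<le> real n * \<rho>" using C n0 by simp
      qed (use \<delta>0 in simp)
      finally show ?thesis using 1 by (simp add: algebra_simps)
    qed
    finally have "\<bar>swap_avg n g x - swap_avg n g z\<bar> \<le> (real n * ((1 + \<delta>) * \<rho>)) * \<rho> ^ t / real n"
      using \<rho>0 n0 by (simp add: divide_right_mono mult_right_mono)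
    then show ?thesis using True n0 by (simp add: g_def \<rho>_def \<delta>_def mult_ac)
  qed
qed


text \<open>A mixture of two placements stays injective because their images are disjoint; this is
  why paths between placements are routed through a disjoint one.\<close>

lemma placement_override_on:
  assumes "placement n C y" "placement n C w" "y ` C \<inter> w ` C = {}"
  shows "placement n C (override_on y w S)"
  using assms unfolding placement_def inj_on_def override_on_def by (auto split: if_splits)

text \<open>Any two placements are joined through a third one disjoint from both, changing the location
  of one card at a time.\<close>

lemma placement_discrepancy:
  fixes f :: "(nat \<Rightarrow> nat) \<Rightarrow> real"
  assumes f01: "\<And>x. 0 \<le> f x \<and> f x \<le> 1"
    and fC: "\<And>x y. \<forall>c\<in>C. x c = y c \<Longrightarrow> f x = f y"
    and C: "finite C" "card C = k" "k \<ge> 1" and n: "2 * k + 4 \<le> n" "3 * k \<le> n"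
    and x: "placement n C x" and z: "placement n C z"
  shows "\<bar>(swap_avg n ^^ t) f x - (swap_avg n ^^ t) f z\<bar>
    \<le> 4 * real k * (1 - 1 / real n + 2 * (real k - 1) / (real n)\<^sup>2) ^ t"
proof -
  define g where "g = (swap_avg n ^^ t) f"
  define \<rho> where "\<rho> = 1 - 1 / real n + 2 * (real k - 1) / (real n)\<^sup>2"
  have "1 / real n \<le> 1" "2 * (real k - 1) / (real n)\<^sup>2 \<ge> 0" using n C by simp_all
  then have \<rho>0: "\<rho> \<ge> 0" unfolding \<rho>_def by linarith
  \<comment> \<open>\<open>x\<close> and \<open>z\<close> occupy at most \<open>2 * k\<close>
    locations, so \<open>3 * k \<le> n\<close> leaves room for the intermediate placement
    \<open>w\<close>.\<close>
  have "card C \<le> card ({1..n} - (x ` C \<union> z ` C))"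
  proof -
    have "card (x ` C \<union> z ` C) \<le> k + k"
      using card_Un_le[of "x ` C" "z ` C"] card_image_le[OF C(1), of x] card_image_le[OF C(1), of z] C
      by linarith
    moreover have "card {1..n} - card (x ` C \<union> z ` C) \<le> card ({1..n} - (x ` C \<union> z ` C))"
      using C by (intro diff_card_le_card_Diff) simp
    ultimately show ?thesis using n C by simp
  qed
  then obtain w where w: "w ` C \<subseteq> {1..n} - (x ` C \<union> z ` C)" "inj_on w C"
    using card_le_inj[OF C(1)] by (metis finite_Diff finite_atLeastAtMost)
  have wp: "placement n C w" using w by (auto simp: placement_def)
  have move: "\<bar>g y - g w\<bar> \<le> real k * (2 * \<rho> ^ t)" if y: "placement n C y" "y ` C \<inter> w ` C = {}" for y
  proof -
    \<comment> \<open>\<open>S\<close> is the set of cards already moved to their locations under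
      \<open>w\<close>. Each further card costs at most
      \<open>(1 + 2 / n) * \<rho> ^ t \<le> 2 * \<rho> ^ t\<close>; the two paths of
      \<open>k\<close> moves together give the factor \<open>4 * k\<close>.\<close>
    have "\<bar>g y - g (override_on y w S)\<bar> \<le> real (card S) * (2 * \<rho> ^ t)" if "S \<subseteq> C" for S
      using finite_subset[OF that C(1)] that
    proof (induction S rule: finite_induct)
      case (insert j S)
      let ?u = "override_on y w S" and ?v = "override_on y w (insert j S)"
      have j: "j \<in> C" using insert by simp
      have "\<bar>g ?u - g ?v\<bar> \<le> (if 1 \<in> ?u ` C \<union> ?v ` C then 1 + 2 / real n else 1) * \<rho> ^ t"
        unfolding g_def \<rho>_def
      proof (rule one_card_discrepancy[OF f01 fC C n(1) j])
        show "?u j \<noteq> ?v j" using y(2) j insert by (auto simp: override_on_def)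
        show "placement n C ?u" "placement n C ?v"
          using y wp by (simp_all only: placement_override_on)
      qed (auto simp: override_on_def)
      also have "\<dots> \<le> 2 * \<rho> ^ t"
        using n \<rho>0 by (intro mult_right_mono) auto
      finally have "\<bar>g ?u - g ?v\<bar> \<le> 2 * \<rho> ^ t" .
      then have "\<bar>g y - g ?v\<bar> \<le> real (card S) * (2 * \<rho> ^ t) + 2 * \<rho> ^ t"
        using insert.IH insert.prems by fastforce
      also have "\<dots> = real (card (insert j S)) * (2 * \<rho> ^ t)"
        using insert.hyps by (simp add: algebra_simps)
      finally show ?case .
    qed simp
    from this[of C] have "\<bar>g y - g (override_on y w C)\<bar> \<le> real k * (2 * \<rho> ^ t)"
      using C by simp
    moreover have "g (override_on y w C) = g w"
      unfolding g_def using fC by (rule swap_avg_cong_on) auto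
    ultimately show ?thesis by simp
  qed
  have "\<bar>g x - g w\<bar> \<le> real k * (2 * \<rho> ^ t)" "\<bar>g z - g w\<bar> \<le> real k * (2 * \<rho> ^ t)"
    using w x z by (auto intro!: move)
  then have "\<bar>g x - g z\<bar> \<le> 4 * real k * \<rho> ^ t" by linarith
  then show ?thesis by (simp add: g_def \<rho>_def)
qed

lemma placement_inv_deck:
  assumes "\<sigma> \<in> decks n" "C \<subseteq> {1..n}"
  shows "placement n C (inv \<sigma>)"
proof -
  have "inv \<sigma> permutes {1..n}" using assms by (auto simp: decks_def intro: permutes_inv)
  then show ?thesis
    using assms(2) permutes_inj_on[of "inv \<sigma>" "{1..n}" C] permutes_in_image[of "inv \<sigma>" "{1..n}"]
    by (auto simp: placement_def)
qed

section \<open>Total variation distance and its maxima over decks and card sets\<close>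

lemma abs_prob_diff_le_1: "\<bar>measure_pmf.prob p A - measure_pmf.prob q A\<bar> \<le> 1"
  using measure_pmf.prob_le_1[of p A] measure_pmf.prob_le_1[of q A]
    measure_nonneg[of p A] measure_nonneg[of q A] by linarith

lemma tv_dist_ge: "\<bar>measure_pmf.prob p A - measure_pmf.prob q A\<bar> \<le> tv_dist p q"
  unfolding tv_dist_def by (intro cSUP_upper bdd_aboveI2[where M = 1] abs_prob_diff_le_1) simp

lemma tv_dist_le:
  assumes "\<And>A. \<bar>measure_pmf.prob p A - measure_pmf.prob q A\<bar> \<le> e"
  shows "tv_dist p q \<le> e"
  unfolding tv_dist_def by (intro cSUP_least assms) simp

lemma tv_dist_le_1: "tv_dist p q \<le> 1"
  by (intro tv_dist_le abs_prob_diff_le_1)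

lemma finite_card_subsets: "finite {C. C \<subseteq> {1..n::nat} \<and> card C = k}"
  by (rule finite_subset[of _ "Pow {1..n}"]) auto

lemma max_partial_dist_ge:
  assumes "C \<subseteq> {1..n}" "card C = k" "\<sigma> \<in> decks n"
  shows "tv_dist (locations_law (sorted_list_of_set C) (shuffle_law P n \<sigma> (nat \<lfloor>s\<rfloor>)))
                 (locations_law (sorted_list_of_set C) (pmf_of_set (decks n)))
         \<le> max_partial_dist P n k s"
proof -
  have "tv_dist (locations_law (sorted_list_of_set C) (shuffle_law P n \<sigma> (nat \<lfloor>s\<rfloor>)))
                 (locations_law (sorted_list_of_set C) (pmf_of_set (decks n)))
         \<le> partial_dist P n (sorted_list_of_set C) s"
    unfolding partial_dist_def using assms finite_decks by (intro Max_ge) auto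
  also have "\<dots> \<le> max_partial_dist P n k s"
    unfolding max_partial_dist_def using assms finite_card_subsets[of n k] by (intro Max_ge) auto
  finally show ?thesis .
qed

lemma max_partial_dist_le:
  assumes "k \<le> n"
    and "\<And>C \<sigma>. C \<subseteq> {1..n} \<Longrightarrow> card C = k \<Longrightarrow> \<sigma> \<in> decks n \<Longrightarrow>
      tv_dist (locations_law (sorted_list_of_set C) (shuffle_law P n \<sigma> (nat \<lfloor>s\<rfloor>)))
              (locations_law (sorted_list_of_set C) (pmf_of_set (decks n))) \<le> e"
  shows "max_partial_dist P n k s \<le> e"
proof -
  have "{C. C \<subseteq> {1..n} \<and> card C = k} \<noteq> {}"
    using obtain_subset_with_card_n[of k "{1..n}"] assms(1) by auto
  moreover have "partial_dist P n (sorted_list_of_set C) s \<le> e" if "C \<subseteq> {1..n}" "card C = k" for C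
    unfolding partial_dist_def using assms(2)[OF that] finite_decks id_in_decks
    by (intro Max.boundedI) auto
  ultimately show ?thesis
    unfolding max_partial_dist_def using finite_card_subsets[of n k] by (intro Max.boundedI) auto
qed

lemma max_partial_dist_nonneg:
  assumes "k \<le> n"
  shows "0 \<le> max_partial_dist P n k s"
proof -
  obtain C where C: "C \<subseteq> {1..n}" "card C = k"
    using obtain_subset_with_card_n[of k "{1..n}"] assms by auto
  have "0 \<le> tv_dist p q" for p q :: "nat list pmf"
    using tv_dist_ge[of p "{}" q] by simp
  also note max_partial_dist_ge[OF C id_in_decks]
  finally show ?thesis .
qed

lemma max_partial_dist_le_1:
  assumes "k \<le> n"
  shows "max_partial_dist P n k s \<le> 1"
  by (intro max_partial_dist_le assms tv_dist_le_1)

section \<open>Upper bound on the distance\<close>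

text \<open>By stationarity, the uniform probability of an event is the average over all decks
  \<open>\<pi>\<close> of its probability after \<open>t\<close> steps from \<open>\<pi>\<close>.
  The difference to be bounded is then an average of discrepancies between two starting
  placements.\<close>

lemma max_partial_dist_upper:
  assumes k: "k \<ge> 1" and n: "2 * k + 4 \<le> n" "3 * k \<le> n"
  shows "max_partial_dist top_to_random_transposition n k s
    \<le> 4 * real k * (1 - 1 / real n + 2 * (real k - 1) / (real n)\<^sup>2) ^ nat \<lfloor>s\<rfloor>"
proof (rule max_partial_dist_le)
  fix C \<sigma>
  assume C: "C \<subseteq> {1..n}" "card C = k" and \<sigma>: "\<sigma> \<in> decks n"
  define t where "t = nat \<lfloor>s\<rfloor>"
  define e where "e = 4 * real k * (1 - 1 / real n + 2 * (real k - 1) / (real n)\<^sup>2) ^ t"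
  let ?cs = "sorted_list_of_set C" and ?D = "decks n"
  have finC: "finite C" using C finite_subset by blast
  have n1: "n \<ge> 1" using n by simp
  have "\<bar>measure_pmf.prob (locations_law ?cs (shuffle_law top_to_random_transposition n \<sigma> t)) A -
         measure_pmf.prob (locations_law ?cs (pmf_of_set ?D)) A\<bar> \<le> e" for A
  proof -
    define f :: "(nat \<Rightarrow> nat) \<Rightarrow> real" where "f x = indicator A (map x ?cs)" for x
    define g where "g = (swap_avg n ^^ t) f"
    have cD: "real (card ?D) > 0"
      using finite_decks id_in_decks by (auto simp: card_gt_0_iff)
    have 1: "measure_pmf.prob (locations_law ?cs (shuffle_law top_to_random_transposition n \<sigma> t)) A
        = g (inv \<sigma>)"
      using expectation_shuffle_law[OF n1 \<sigma>, of t f] by (simp add: prob_locations_law f_def g_def)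
    have "measure_pmf.prob (locations_law ?cs (pmf_of_set ?D)) A = (\<Sum>\<pi>\<in>?D. f (inv \<pi>)) / card ?D"
      using id_in_decks finite_decks by (subst prob_locations_law, subst integral_pmf_of_set) (auto simp: f_def)
    also have "\<dots> = (\<Sum>\<pi>\<in>?D. g (inv \<pi>)) / card ?D"
      by (simp add: g_def sum_funpow_swap_avg_decks[OF n1])
    finally have "g (inv \<sigma>) - measure_pmf.prob (locations_law ?cs (pmf_of_set ?D)) A
        = (\<Sum>\<pi>\<in>?D. g (inv \<sigma>) - g (inv \<pi>)) / card ?D"
      using cD by (simp add: sum_subtractf diff_divide_distrib)
    moreover have "\<bar>\<Sum>\<pi>\<in>?D. g (inv \<sigma>) - g (inv \<pi>)\<bar> \<le> (\<Sum>\<pi>\<in>?D. e)"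
    proof (intro order_trans[OF sum_abs] sum_mono)
      fix \<pi> assume \<pi>: "\<pi> \<in> ?D"
      show "\<bar>g (inv \<sigma>) - g (inv \<pi>)\<bar> \<le> e"
        unfolding g_def e_def
      proof (rule placement_discrepancy[OF _ _ finC C(2) k n])
        show "f x = f y" if "\<forall>c\<in>C. x c = y c" for x y
        proof -
          have "map x ?cs = map y ?cs" using that finC by simp
          then show ?thesis by (simp only: f_def)
        qed
      qed (use placement_inv_deck[OF \<sigma> C(1)] placement_inv_deck[OF \<pi> C(1)] in
          \<open>auto simp: f_def indicator_def\<close>)
    qed
    ultimately show ?thesis
      using cD by (simp add: 1 pos_divide_le_eq mult.commute)
  qed
  then show "tv_dist (locations_law ?cs (shuffle_law top_to_random_transposition n \<sigma> (nat \<lfloor>s\<rfloor>)))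
      (locations_law ?cs (pmf_of_set ?D))
      \<le> 4 * real k * (1 - 1 / real n + 2 * (real k - 1) / (real n)\<^sup>2) ^ nat \<lfloor>s\<rfloor>"
    unfolding t_def e_def by (rule tv_dist_le)
qed (use n in simp)

section \<open>Lower bound on the distance by missing coupons\<close>

text \<open>The right-hand side is the expectation of \<open>(1 - a X)\<^sup>2\<close>, where \<open>X\<close> is the number of locations
  in \<open>S\<close> that are not chosen up to time \<open>t\<close>.\<close>

lemma no_fixed_card_bound:
  fixes a :: real
  assumes n: "n \<ge> 1" and SC: "S \<subseteq> C" and Sn: "S \<subseteq> {2..n}" and fixed: "\<forall>c\<in>S. y c = c"
  defines "f \<equiv> \<lambda>x :: nat \<Rightarrow> nat. of_bool (\<exists>c\<in>C. x c = c)"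
  shows "1 - (swap_avg n ^^ t) f y
    \<le> 1 - 2 * real (card S) * (1 - 1 / real n) ^ t * a
      + (real (card S) * (real (card S) - 1) * (1 - 2 / real n) ^ t
         + real (card S) * (1 - 1 / real n) ^ t) * a\<^sup>2"
  using SC Sn fixed
proof (induction t arbitrary: S y)
  case 0
  \<comment> \<open>At time 0 every coupon in \<open>S\<close> is missing, so the square is taken at
    \<open>X = card S\<close>; the left side vanishes unless \<open>S\<close> is empty.\<close>
  have "1 - f y \<le> (1 - real (card S) * a)\<^sup>2"
  proof (cases "S = {}")
    case False
    then have "f y = 1" using 0 by (auto simp: f_def)
    then show ?thesis by simp
  qed (simp add: f_def)
  then show ?case by (simp add: power2_eq_square algebra_simps)
next
  case (Suc t)
  define m where "m = real (card S)"
  define P where "P = (1 - 1 / real n) ^ t"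
  define Q where "Q = (1 - 2 / real n) ^ t"
  define \<psi> where "\<psi> r = 1 - 2 * r * P * a + (r * (r - 1) * Q + r * P) * a\<^sup>2" for r
  define g where "g = (swap_avg n ^^ t) f"
  have finS: "finite S" using Suc.prems finite_subset by blast
  \<comment> \<open>Choosing \<open>R\<close> in \<open>S\<close> spoils only that coupon. The card
    on top is never counted, as \<open>S\<close> avoids location 1.\<close>
  have IH: "1 - g (Transposition.transpose 1 R \<circ> y) \<le> (if R \<in> S then \<psi> (m - 1) else \<psi> m)" for R
  proof -
    have "1 - g (Transposition.transpose 1 R \<circ> y) \<le> \<psi> (real (card (S - {R})))"
      unfolding g_def \<psi>_def P_def Q_def
    proof (rule Suc.IH)
      show "\<forall>c\<in>S - {R}. (Transposition.transpose 1 R \<circ> y) c = c"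
      proof
        fix c assume "c \<in> S - {R}"
        then have "y c = c" "c \<noteq> 1" "c \<noteq> R" using Suc.prems by auto
        then show "(Transposition.transpose 1 R \<circ> y) c = c" by simp
      qed
    qed (use Suc.prems in auto)
    moreover have "real (card (S - {R})) = (if R \<in> S then m - 1 else m)"
      using card_Suc_Diff1[OF finS, of R] by (auto simp: m_def)
    ultimately show ?thesis by (simp split: if_splits)
  qed
  have n0: "real n > 0" using n by simp
  have "1 - swap_avg n g y = (\<Sum>R=1..n. 1 - g (Transposition.transpose 1 R \<circ> y)) / n"
    using n0 by (simp add: swap_avg_def sum_subtractf diff_divide_distrib)
  also have "\<dots> \<le> (\<Sum>R=1..n. if R \<in> S then \<psi> (m - 1) else \<psi> m) / n"
    by (intro divide_right_mono sum_mono IH) simp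
  also have "(\<Sum>R=1..n. if R \<in> S then \<psi> (m - 1) else \<psi> m)
      = (\<Sum>R=1..n. \<psi> m + (if R \<in> S then \<psi> (m - 1) - \<psi> m else 0))"
    by (intro sum.cong) auto
  also have "\<dots> = n * \<psi> m + m * (\<psi> (m - 1) - \<psi> m)"
  proof -
    have "{1..n} \<inter> S = S" using Suc.prems by auto
    then show ?thesis by (simp add: sum.distrib sum.If_cases m_def)
  qed
  \<comment> \<open>With probability \<open>m / n\<close> the count drops by one, which lowers
    \<open>m\<close> by 1 and \<open>m * (m - 1)\<close> by \<open>2 * (m - 1)\<close>. On average
    the two factorial moments are thus multiplied by \<open>1 - 1 / n\<close> and
    \<open>1 - 2 / n\<close>.\<close>
  also have "\<dots> / n = 1 - 2 * m * ((1 - 1 / real n) * P) * a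
      + (m * (m - 1) * ((1 - 2 / real n) * Q) + m * ((1 - 1 / real n) * P)) * a\<^sup>2"
    using n0 by (simp add: \<psi>_def field_simps)
  finally show ?case by (simp add: g_def m_def P_def Q_def)
qed

text \<open>The decks that fix \<open>c\<close> are the permutations of the other
  \<open>n - 1\<close> labels.\<close>

lemma card_decks_fixing:
  assumes "c \<in> {1..n}"
  shows "real (card {\<sigma> \<in> decks n. inv \<sigma> c = c}) = real (card (decks n)) / real n"
proof -
  have "{\<sigma> \<in> decks n. inv \<sigma> c = c} = {\<sigma>. \<sigma> permutes ({1..n} - {c})}"
  proof (intro equalityI subsetI)
    fix \<sigma> assume "\<sigma> \<in> {\<sigma> \<in> decks n. inv \<sigma> c = c}"
    then have \<sigma>: "\<sigma> permutes {1..n}" "\<sigma> c = c"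
      using permutes_inverses(1)[of \<sigma> "{1..n}" c] by (auto simp: decks_def)
    have "\<sigma> permutes ({1..n} - {c})"
      by (rule permutes_superset[OF \<sigma>(1)]) (use \<sigma>(2) in auto)
    then show "\<sigma> \<in> {\<sigma>. \<sigma> permutes ({1..n} - {c})}" by simp
  next
    fix \<sigma> assume "\<sigma> \<in> {\<sigma>. \<sigma> permutes ({1..n} - {c})}"
    then have \<sigma>: "\<sigma> permutes ({1..n} - {c})" by simp
    then have "inv \<sigma> permutes ({1..n} - {c})" by (rule permutes_inv)
    then have "inv \<sigma> c = c" by (auto simp: permutes_def)
    then show "\<sigma> \<in> {\<sigma> \<in> decks n. inv \<sigma> c = c}"
      using permutes_subset[OF \<sigma>, of "{1..n}"] by (auto simp: decks_def)
  qed
  then have "card {\<sigma> \<in> decks n. inv \<sigma> c = c} = fact (n - 1)"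
    using assms by (simp add: card_permutations[of _ "n - 1"])
  moreover have "card (decks n) = fact n"
    by (simp add: decks_def card_permutations)
  moreover have "fact n = real n * fact (n - 1)"
    using assms by (intro fact_reduce) auto
  ultimately show ?thesis using assms by simp
qed

text \<open>The distinguishing event is that some card of \<open>C\<close> sits at its original
  location, starting from the deck \<open>id\<close>. The choice \<open>C = {2..k + 1}\<close> keeps
  the tracked cards off the top. The parameters \<open>m\<close> and \<open>a\<close> stay free:
  \<open>m = k\<close> with \<open>a\<close> the reciprocal mean serves growing \<open>k\<close>,
  and \<open>m = a = 1\<close> serves bounded \<open>k\<close>.\<close>

lemma max_partial_dist_lower:
  fixes a :: real
  assumes k: "k < n" and m: "m \<le> k"
  shows "2 * real m * (1 - 1 / real n) ^ nat \<lfloor>s\<rfloor> * a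
      - (real m * (real m - 1) * (1 - 2 / real n) ^ nat \<lfloor>s\<rfloor>
         + real m * (1 - 1 / real n) ^ nat \<lfloor>s\<rfloor>) * a\<^sup>2 - real k / real n
    \<le> max_partial_dist top_to_random_transposition n k s"
proof -
  define t where "t = nat \<lfloor>s\<rfloor>"
  define C where "C = {2..k + 1}"
  define S where "S = {2..m + 1}"
  define f :: "(nat \<Rightarrow> nat) \<Rightarrow> real" where "f = (\<lambda>x. of_bool (\<exists>c\<in>C. x c = c))"
  let ?cs = "sorted_list_of_set C" and ?D = "decks n"
  have C: "C \<subseteq> {1..n}" "card C = k" using k by (auto simp: C_def)
  have n1: "n \<ge> 1" using k by simp
  \<comment> \<open>The event as a set of location lists. A list determines \<open>x\<close> on
    \<open>C\<close>, so membership does not depend on the representative \<open>x\<close>.\<close>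
  define A where "A = (\<lambda>x. map x ?cs) ` {x. \<exists>c\<in>C. x c = c}"
  have ind: "indicator A (map x ?cs) = f x" for x
  proof -
    have "map x ?cs \<in> A \<longleftrightarrow> (\<exists>c\<in>C. x c = c)"
    proof
      assume "map x ?cs \<in> A"
      then obtain y c where y: "map x ?cs = map y ?cs" "c \<in> C" "y c = c" unfolding A_def by blast
      then have "x c = y c" using y(1) by (simp add: C_def)
      with y show "\<exists>c\<in>C. x c = c" by auto
    qed (auto simp: A_def)
    then show ?thesis by (simp add: f_def indicator_def)
  qed
  have 1: "measure_pmf.prob (locations_law ?cs (shuffle_law top_to_random_transposition n id t)) A
      = (swap_avg n ^^ t) f id"
    using expectation_shuffle_law[OF n1 id_in_decks, of t f] by (simp add: prob_locations_law ind)
  have 2: "1 - (swap_avg n ^^ t) f id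
    \<le> 1 - 2 * real m * (1 - 1 / real n) ^ t * a
      + (real m * (real m - 1) * (1 - 2 / real n) ^ t + real m * (1 - 1 / real n) ^ t) * a\<^sup>2"
    using no_fixed_card_bound[OF n1, of S C id t a] k m by (auto simp: S_def C_def f_def)
  have "measure_pmf.prob (locations_law ?cs (pmf_of_set ?D)) A = (\<Sum>\<pi>\<in>?D. f (inv \<pi>)) / card ?D"
    using id_in_decks finite_decks by (subst prob_locations_law, subst integral_pmf_of_set) (auto simp: ind)
  \<comment> \<open>Union bound over the tracked cards, each of which is at its original location in
    a fraction \<open>1 / n\<close> of all decks.\<close>
  also have "\<dots> \<le> (\<Sum>\<pi>\<in>?D. \<Sum>c\<in>C. of_bool (inv \<pi> c = c)) / card ?D"
  proof (intro divide_right_mono sum_mono)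
    show "f (inv \<pi>) \<le> (\<Sum>c\<in>C. of_bool (inv \<pi> c = c))" for \<pi>
    proof (cases "\<exists>c\<in>C. inv \<pi> c = c")
      case True
      then obtain c where c: "c \<in> C" "inv \<pi> c = c" by blast
      then have "(1 :: real) = (\<Sum>c\<in>{c}. of_bool (inv \<pi> c = c))" by simp
      also have "\<dots> \<le> (\<Sum>c\<in>C. of_bool (inv \<pi> c = c))"
        using c by (intro sum_mono2) (auto simp: C_def)
      finally show ?thesis using True by (simp add: f_def)
    qed (simp add: f_def)
  qed simp
  also have "(\<Sum>\<pi>\<in>?D. \<Sum>c\<in>C. of_bool (inv \<pi> c = c)) = (\<Sum>c\<in>C. real (card {\<pi> \<in> ?D. inv \<pi> c = c}))"
    using finite_decks[of n] by (subst sum.swap) (simp add: of_bool_def sum.If_cases Int_def)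
  also have "\<dots> = (\<Sum>c\<in>C. real (card ?D) / real n)"
    using C by (intro sum.cong card_decks_fixing) auto
  also have "\<dots> / card ?D = real k / real n"
    using C finite_decks[of n] id_in_decks[of n] by (auto simp: card_eq_0_iff)
  finally have 3: "measure_pmf.prob (locations_law ?cs (pmf_of_set ?D)) A \<le> real k / real n" .
  show ?thesis
    using 1 2 3 order_trans[OF tv_dist_ge[of _ A] max_partial_dist_ge[OF C id_in_decks,
        where P = top_to_random_transposition and s = s]]
    unfolding t_def[symmetric] by linarith
qed

section \<open>Exponential forms of the bounds at real times\<close>

text \<open>The rate is at most \<open>1 - c \<le> exp (- c)\<close> with
  \<open>c = (1 - 2 * k / n) / n\<close>. Rounding the time down costs at most
  \<open>c \<le> 1\<close> in the exponent, which is the summand 1.\<close>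

lemma max_partial_dist_upper_exp:
  assumes k: "k \<ge> 1" and n: "2 * k + 4 \<le> n" "3 * k \<le> n"
  shows "max_partial_dist top_to_random_transposition n k s
    \<le> 4 * real k * exp (1 - (1 - 2 * real k / real n) * (s / real n))"
proof -
  define \<rho> where "\<rho> = 1 - 1 / real n + 2 * (real k - 1) / (real n)\<^sup>2"
  define c where "c = (1 - 2 * real k / real n) / real n"
  have n0: "real n > 0" using n by simp
  have "1 / real n \<le> 1" "2 * (real k - 1) / (real n)\<^sup>2 \<ge> 0" using n k by simp_all
  then have \<rho>0: "\<rho> \<ge> 0" unfolding \<rho>_def by linarith
  have c: "0 \<le> c" "c \<le> 1"
  proof -
    have "0 \<le> 1 - 2 * real k / real n" using n n0 by simp
    then show "0 \<le> c" using n0 by (simp add: c_def)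
    have "0 \<le> 2 * real k / real n" "1 \<le> real n" using n by simp_all
    then have "1 - 2 * real k / real n \<le> real n" by linarith
    then show "c \<le> 1" using n0 by (simp add: c_def)
  qed
  have "\<rho> \<le> 1 + (- c)"
    using n0 by (simp add: \<rho>_def c_def field_simps power2_eq_square)
  also have "\<dots> \<le> exp (- c)" by (rule exp_ge_add_one_self)
  finally have "\<rho> ^ nat \<lfloor>s\<rfloor> \<le> exp (- c) ^ nat \<lfloor>s\<rfloor>"
    using \<rho>0 by (intro power_mono) auto
  also have "\<dots> = exp (- (c * real (nat \<lfloor>s\<rfloor>)))"
    by (simp add: exp_of_nat_mult[symmetric] mult.commute)
  also have "\<dots> \<le> exp (1 - c * s)"
  proof -
    have "s - 1 \<le> real (nat \<lfloor>s\<rfloor>)" by linarith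
    then have "c * (s - 1) \<le> c * real (nat \<lfloor>s\<rfloor>)"
      using c by (intro mult_left_mono)
    then show ?thesis using c by (simp add: algebra_simps)
  qed
  finally have "4 * real k * \<rho> ^ nat \<lfloor>s\<rfloor> \<le> 4 * real k * exp (1 - c * s)"
    by (intro mult_left_mono) auto
  then show ?thesis
    using max_partial_dist_upper[OF k n, of s] by (simp add: \<rho>_def c_def)
qed

text \<open>The reciprocal of \<open>1 - 1 / n\<close> is
  \<open>1 + 1 / (n - 1) \<le> exp (1 / (n - 1))\<close>. The maximum with 0 reflects that negative
  times are read as time 0.\<close>

lemma one_minus_inverse_power_ge:
  assumes "n \<ge> 2"
  shows "exp (- (max 0 s / (real n - 1))) \<le> (1 - 1 / real n) ^ nat \<lfloor>s\<rfloor>"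
proof -
  have n1: "real n - 1 > 0" using assms by simp
  have "real n / (real n - 1) = 1 + 1 / (real n - 1)"
    using n1 by (simp add: field_simps)
  also have "\<dots> \<le> exp (1 / (real n - 1))" by (rule exp_ge_add_one_self)
  finally have "exp (- (1 / (real n - 1))) \<le> 1 - 1 / real n"
    using n1 by (simp add: exp_minus field_simps)
  then have "exp (- (1 / (real n - 1))) ^ nat \<lfloor>s\<rfloor> \<le> (1 - 1 / real n) ^ nat \<lfloor>s\<rfloor>"
    by (intro power_mono) auto
  moreover have "exp (- (1 / (real n - 1))) ^ nat \<lfloor>s\<rfloor> = exp (- (real (nat \<lfloor>s\<rfloor>) / (real n - 1)))"
    by (simp add: exp_of_nat_mult[symmetric])
  moreover have "exp (- (max 0 s / (real n - 1))) \<le> exp (- (real (nat \<lfloor>s\<rfloor>) / (real n - 1)))"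
  proof -
    have "real (nat \<lfloor>s\<rfloor>) \<le> max 0 s" by linarith
    then show ?thesis using n1 by (simp add: divide_right_mono)
  qed
  ultimately show ?thesis by linarith
qed

text \<open>Here \<open>m = k\<close> and \<open>a = 1 / \<mu>\<close>, where \<open>\<mu>\<close>
  is the mean number of missing coupons; the bound becomes
  \<open>1 - 1 / \<mu> - k / n\<close>.\<close>

lemma max_partial_dist_lower_many:
  assumes k: "1 \<le> k" "k < n"
  shows "1 - exp (max 0 s / (real n - 1)) / real k - real k / real n
    \<le> max_partial_dist top_to_random_transposition n k s"
proof -
  define P where "P = (1 - 1 / real n) ^ nat \<lfloor>s\<rfloor>"
  define Q where "Q = (1 - 2 / real n) ^ nat \<lfloor>s\<rfloor>"
  define \<mu> where "\<mu> = real k * P"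
  have n: "n \<ge> 2" "real n \<ge> 2" using k by auto
  have P: "exp (- (max 0 s / (real n - 1))) \<le> P"
    unfolding P_def using n(1) by (rule one_minus_inverse_power_ge)
  have P0: "P > 0" by (rule less_le_trans[OF exp_gt_zero P])
  then have \<mu>0: "\<mu> > 0" using k by (simp add: \<mu>_def)
  \<comment> \<open>Two given coupons are missing with probability at most the product of their
    individual probabilities, so the second moment is at most
    \<open>\<mu>^2 + \<mu>\<close>.\<close>
  have "1 - 2 / real n \<le> (1 - 1 / real n)\<^sup>2"
    by (simp add: power2_eq_square algebra_simps)
  then have "Q \<le> ((1 - 1 / real n)\<^sup>2) ^ nat \<lfloor>s\<rfloor>"
    unfolding Q_def using n by (intro power_mono) auto
  also have "\<dots> = P\<^sup>2" by (simp add: P_def mult.commute flip: power_mult)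
  finally have "Q \<le> P\<^sup>2" .
  moreover have "real k * (real k - 1) \<le> (real k)\<^sup>2" "0 \<le> real k * (real k - 1)"
    using k by (simp_all add: power2_eq_square algebra_simps)
  moreover have "0 \<le> Q" using n by (simp add: Q_def)
  ultimately have "real k * (real k - 1) * Q \<le> (real k)\<^sup>2 * P\<^sup>2"
    by (intro mult_mono) auto
  then have "real k * (real k - 1) * Q \<le> \<mu>\<^sup>2" by (simp add: \<mu>_def power_mult_distrib)
  then have "(real k * (real k - 1) * Q + \<mu>) * (1 / \<mu>)\<^sup>2 \<le> (\<mu>\<^sup>2 + \<mu>) * (1 / \<mu>)\<^sup>2"
    by (intro mult_right_mono) auto
  also have "\<dots> = 1 + 1 / \<mu>" using \<mu>0 by (simp add: power2_eq_square field_simps)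
  finally have "1 - 1 / \<mu> \<le> 2 * \<mu> * (1 / \<mu>) - (real k * (real k - 1) * Q + \<mu>) * (1 / \<mu>)\<^sup>2"
    using \<mu>0 by simp
  moreover have "2 * \<mu> * (1 / \<mu>) - (real k * (real k - 1) * Q + \<mu>) * (1 / \<mu>)\<^sup>2 - real k / real n
      \<le> max_partial_dist top_to_random_transposition n k s"
    using max_partial_dist_lower[OF k(2) order_refl, of s "1 / \<mu>"]
    by (simp only: P_def Q_def \<mu>_def mult.assoc)
  moreover have "1 / \<mu> \<le> exp (max 0 s / (real n - 1)) / real k"
  proof -
    have "1 / P \<le> exp (max 0 s / (real n - 1))"
      using P P0 by (simp add: exp_minus field_simps)
    then have "1 / P / real k \<le> exp (max 0 s / (real n - 1)) / real k"
      by (intro divide_right_mono) auto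
    then show ?thesis by (simp add: \<mu>_def mult.commute)
  qed
  ultimately show ?thesis by linarith
qed

text \<open>A single coupon, with \<open>m = a = 1\<close>. Its bound stays positive at any fixed
  multiple of \<open>n\<close> once \<open>k / n\<close> is small, as is required for bounded
  \<open>k\<close>.\<close>

lemma max_partial_dist_lower_one:
  assumes k: "1 \<le> k" "k < n"
  shows "exp (- (max 0 s / (real n - 1))) - real k / real n
    \<le> max_partial_dist top_to_random_transposition n k s"
proof -
  have "exp (- (max 0 s / (real n - 1))) \<le> (1 - 1 / real n) ^ nat \<lfloor>s\<rfloor>"
    using k by (intro one_minus_inverse_power_ge) simp
  then show ?thesis using max_partial_dist_lower[OF k(2) k(1), of s 1] by simp
qed

section \<open>Cutoff for a growing number of tracked cards\<close>

text \<open>Eventually \<open>k^2 \<le> n / ln n\<close>, and \<open>ln n\<close> exceeds any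
  constant. All error terms of the cutoff estimate are controlled by
  \<open>k^2 = o(n)\<close>.\<close>

lemma eventually_square_mult_le:
  fixes k :: "nat \<Rightarrow> nat"
  assumes "(\<lambda>n. real (k n)) \<in> o(\<lambda>n. sqrt (real n / ln (real n)))"
  shows "eventually (\<lambda>n. M * (real (k n))\<^sup>2 \<le> real n) sequentially"
proof -
  have "eventually (\<lambda>n. norm (real (k n)) \<le> 1 * norm (sqrt (real n / ln (real n)))) sequentially"
    by (rule landau_o.smallD[OF assms]) simp
  moreover have "eventually (\<lambda>n. max M 1 \<le> ln (real n)) sequentially"
    using filterlim_compose[OF ln_at_top filterlim_real_sequentially]
    unfolding filterlim_at_top by blast
  ultimately show ?thesis
  proof eventually_elim
    case (elim n)
    have ln0: "ln (real n) > 0" and nn: "real n / ln (real n) \<ge> 0" using elim(2) by auto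
    have "real (k n) \<le> sqrt (real n / ln (real n))" using elim(1) nn by simp
    then have "(real (k n))\<^sup>2 \<le> (sqrt (real n / ln (real n)))\<^sup>2" by (intro power_mono) auto
    also have "\<dots> = real n / ln (real n)" using nn by simp
    finally have "ln (real n) * (real (k n))\<^sup>2 \<le> real n"
      using ln0 by (simp add: field_simps)
    moreover have "M * (real (k n))\<^sup>2 \<le> ln (real n) * (real (k n))\<^sup>2"
      using elim(2) by (intro mult_right_mono) auto
    ultimately show ?case by linarith
  qed
qed

lemma cutoff_unbounded:
  fixes k :: "nat \<Rightarrow> nat"
  assumes k: "\<forall>n\<ge>1. k n \<in> {1..n}"
    and small: "(\<lambda>n. real (k n)) \<in> o(\<lambda>n. sqrt (real n / ln (real n)))"
    and kinf: "filterlim k at_top sequentially"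
  shows "has_partial_cutoff top_to_random_transposition k (\<lambda>n. real n * ln (real (k n))) real"
proof -
  define d where "d \<alpha> n = max_partial_dist top_to_random_transposition n (k n)
    (real n * ln (real (k n)) + \<alpha> * real n)" for \<alpha> n
  note sq = eventually_square_mult_le[OF small]
  have lninf: "eventually (\<lambda>n. M \<le> ln (real (k n))) sequentially" for M
    using filterlim_compose[OF ln_at_top filterlim_compose[OF filterlim_real_sequentially kinf]]
    unfolding filterlim_at_top by blast
  have ksq: "real (k n) \<le> (real (k n))\<^sup>2" if "n \<ge> 1" for n
    using k that by (intro self_le_power) auto
  have lnk: "ln (real (k n)) \<le> real (k n) - 1" if "n \<ge> 1" for n
  proof -
    have "1 \<le> k n" using k that by simp
    then show ?thesis by (intro ln_le_minus_one) simp
  qed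
  have 1: "real \<in> o(\<lambda>n. real n * ln (real (k n)))"
  proof (rule landau_o.smallI)
    fix c :: real assume c: "c > 0"
    show "eventually (\<lambda>n. norm (real n) \<le> c * norm (real n * ln (real (k n)))) sequentially"
      using lninf[of "1 / c"]
    proof eventually_elim
      case (elim n)
      then have "1 / c \<le> \<bar>ln (real (k n))\<bar>" by linarith
      then have "1 \<le> c * \<bar>ln (real (k n))\<bar>" using c by (simp add: field_simps)
      then have "real n * 1 \<le> real n * (c * \<bar>ln (real (k n))\<bar>)" by (intro mult_left_mono) auto
      then show ?case by (simp add: abs_mult mult_ac)
    qed
  qed
  have upper: "limsup (\<lambda>n. ereal (d \<alpha> n)) \<le> ereal (4 * exp (2 - \<alpha>))" if \<alpha>: "\<alpha> \<ge> 0" for \<alpha>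
  proof (rule Limsup_bounded)
    \<comment> \<open>The constant 6 yields \<open>2 * k + 4 \<le> 6 * k \<le> n\<close>; the
      constant \<open>2 * (1 + \<alpha>)\<close> keeps the error
      \<open>2 * k * (ln k + \<alpha>) / n\<close> in the exponent below 1. With the 1 from rounding
      this gives \<open>2 - \<alpha>\<close>.\<close>
    show "eventually (\<lambda>n. ereal (d \<alpha> n) \<le> ereal (4 * exp (2 - \<alpha>))) sequentially"
      using sq[of 6] sq[of "2 * (1 + \<alpha>)"] eventually_ge_at_top[of 1]
    proof eventually_elim
      case (elim n)
      have k1: "1 \<le> k n" using k elim by auto
      then have k1': "1 \<le> (real (k n))\<^sup>2" by simp
      have n6: "6 * real (k n) \<le> real n" using elim(1) ksq[of n] elim(3) by linarith
      have "real (6 * k n) \<le> real n" using n6 by simp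
      then have n: "2 * k n + 4 \<le> n" "3 * k n \<le> n" using k1 by linarith+
      have n0: "real n > 0" using elim by simp
      have "d \<alpha> n \<le> 4 * real (k n) * exp (1 - (1 - 2 * real (k n) / real n) * (ln (real (k n)) + \<alpha>))"
        using max_partial_dist_upper_exp[OF k1 n, of "real n * ln (real (k n)) + \<alpha> * real n"] n0
        by (simp add: d_def add_divide_distrib)
      also have "\<dots> = 4 * exp (ln (real (k n)) + (1 - (1 - 2 * real (k n) / real n) * (ln (real (k n)) + \<alpha>)))"
        unfolding exp_add using k1 by simp
      also have "\<dots> \<le> 4 * exp (2 - \<alpha>)"
      proof -
        have "ln (real (k n)) \<le> real (k n)" using lnk[of n] elim(3) by linarith
        moreover have "\<alpha> \<le> \<alpha> * real (k n)"
          using k1 \<alpha> mult_left_mono[of 1 "real (k n)" \<alpha>] by simp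
        ultimately have "2 * real (k n) * (ln (real (k n)) + \<alpha>)
            \<le> 2 * real (k n) * (real (k n) + \<alpha> * real (k n))"
          by (intro mult_left_mono add_mono) auto
        also have "\<dots> = 2 * (1 + \<alpha>) * (real (k n))\<^sup>2" by (simp add: power2_eq_square algebra_simps)
        also have "\<dots> \<le> real n" by (rule elim(2))
        finally have "2 * real (k n) / real n * (ln (real (k n)) + \<alpha>) \<le> 1"
          using n0 by (simp add: field_simps)
        then show ?thesis by (simp add: algebra_simps)
      qed
      finally show ?case by simp
    qed
  qed
  have lower: "ereal (1 - exp (\<alpha> + 1) - exp \<alpha>) \<le> liminf (\<lambda>n. ereal (d \<alpha> n))" if \<alpha>: "\<alpha> \<le> 0" for \<alpha>
  proof (rule Liminf_bounded)
    \<comment> \<open>The constant 2 gives \<open>k < n\<close>, the constant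
      \<open>exp (- \<alpha>)\<close> gives \<open>k / n \<le> exp \<alpha>\<close>, and
      \<open>ln k \<ge> - \<alpha>\<close> makes the time nonnegative.\<close>
    show "eventually (\<lambda>n. ereal (1 - exp (\<alpha> + 1) - exp \<alpha>) \<le> ereal (d \<alpha> n)) sequentially"
      using sq[of 2] sq[of "exp (- \<alpha>)"] lninf[of "- \<alpha>"] eventually_ge_at_top[of 2]
    proof eventually_elim
      case (elim n)
      have n1: "n \<ge> 1" and n0: "real n > 0" and nm: "real n - 1 > 0" using elim by auto
      have k1: "1 \<le> k n" using k n1 by auto
      have "2 * real (k n) \<le> real n" using elim(1) ksq[OF n1] by linarith
      then have kn: "k n < n" using k1 by linarith
      let ?l = "ln (real (k n))"
      have s0: "0 \<le> real n * ?l + \<alpha> * real n"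
      proof -
        have "0 \<le> real n * (?l + \<alpha>)" using elim(3) by (intro mult_nonneg_nonneg) auto
        then show ?thesis by (simp add: algebra_simps)
      qed
      \<comment> \<open>Dividing by \<open>n - 1\<close> instead of \<open>n\<close> adds
        \<open>(ln k + \<alpha>) / (n - 1)\<close>, which is at most 1 because
        \<open>ln k \<le> k - 1\<close>.\<close>
      have "(real n * ?l + \<alpha> * real n) / (real n - 1) - ?l = \<alpha> + (?l + \<alpha>) / (real n - 1)"
        using nm by (simp add: field_simps)
      also have "\<dots> \<le> \<alpha> + 1"
        using lnk[OF n1] kn \<alpha> nm by (simp add: field_simps)
      finally have "exp ((real n * ?l + \<alpha> * real n) / (real n - 1) - ?l) \<le> exp (\<alpha> + 1)" by simp
      then have "exp ((real n * ?l + \<alpha> * real n) / (real n - 1)) / real (k n) \<le> exp (\<alpha> + 1)"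
        using k1 unfolding exp_diff by simp
      moreover have "real (k n) / real n \<le> exp \<alpha>"
      proof -
        have "exp (- \<alpha>) * real (k n) \<le> exp (- \<alpha>) * (real (k n))\<^sup>2"
          using ksq[OF n1] by (intro mult_left_mono) auto
        then have "exp (- \<alpha>) * real (k n) \<le> real n" using elim(2) by linarith
        then show ?thesis using n0 by (simp add: exp_minus field_simps)
      qed
      moreover have "1 - exp ((real n * ?l + \<alpha> * real n) / (real n - 1)) / real (k n) - real (k n) / real n
          \<le> d \<alpha> n"
        using max_partial_dist_lower_many[OF k1 kn, of "real n * ?l + \<alpha> * real n"] s0
        by (simp add: d_def max_absorb2)
      ultimately show ?case by simp
    qed
  qed
  have d01: "eventually (\<lambda>n. 0 \<le> ereal (d \<alpha> n) \<and> ereal (d \<alpha> n) \<le> 1) sequentially" for \<alpha>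
    using eventually_ge_at_top[of 1]
  proof eventually_elim
    case (elim n)
    then have "k n \<le> n" using k by auto
    then show ?case
      unfolding d_def using max_partial_dist_nonneg max_partial_dist_le_1 by simp
  qed
  have le: "liminf (\<lambda>n. ereal (d \<alpha> n)) \<le> limsup (\<lambda>n. ereal (d \<alpha> n))" for \<alpha>
    by (intro Liminf_le_Limsup) simp
  have d_ge0: "0 \<le> limsup (\<lambda>n. ereal (d \<alpha> n))" for \<alpha>
    using d01[of \<alpha>] by (intro order_trans[OF Liminf_bounded le]) (auto elim: eventually_mono)
  have d_le1: "liminf (\<lambda>n. ereal (d \<alpha> n)) \<le> 1" for \<alpha>
    using d01[of \<alpha>] by (intro order_trans[OF le Limsup_bounded]) (auto elim: eventually_mono)
  have "((\<lambda>\<alpha>. limsup (\<lambda>n. ereal (d \<alpha> n))) \<longlongrightarrow> 0) at_top"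
  proof (rule tendsto_sandwich[of "\<lambda>_. 0" _ _ "\<lambda>\<alpha>. ereal (4 * exp (2 - \<alpha>))"])
    have "((\<lambda>\<alpha>::real. 4 * exp (2 - \<alpha>)) \<longlongrightarrow> 0) at_top" by real_asymp
    then show "((\<lambda>\<alpha>. ereal (4 * exp (2 - \<alpha>))) \<longlongrightarrow> 0) at_top"
      by (simp add: zero_ereal_def)
    show "eventually (\<lambda>\<alpha>. limsup (\<lambda>n. ereal (d \<alpha> n)) \<le> ereal (4 * exp (2 - \<alpha>))) at_top"
      using eventually_ge_at_top[of 0] by eventually_elim (rule upper)
  qed (use d_ge0 in auto)
  moreover have "((\<lambda>\<alpha>. liminf (\<lambda>n. ereal (d \<alpha> n))) \<longlongrightarrow> 1) at_bot"
  proof (rule tendsto_sandwich[of "\<lambda>\<alpha>. ereal (1 - exp (\<alpha> + 1) - exp \<alpha>)" _ _ "\<lambda>_. 1"])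
    have "((\<lambda>\<alpha>::real. 1 - exp (\<alpha> + 1) - exp \<alpha>) \<longlongrightarrow> 1) at_bot" by real_asymp
    then show "((\<lambda>\<alpha>. ereal (1 - exp (\<alpha> + 1) - exp \<alpha>)) \<longlongrightarrow> 1) at_bot"
      by (simp add: one_ereal_def)
    show "eventually (\<lambda>\<alpha>. ereal (1 - exp (\<alpha> + 1) - exp \<alpha>) \<le> liminf (\<lambda>n. ereal (d \<alpha> n))) at_bot"
      using eventually_le_at_bot[of 0] by eventually_elim (rule lower)
  qed (use d_le1 in auto)
  ultimately show ?thesis
    unfolding has_partial_cutoff_def d_def using 1 by simp
qed

section \<open>No cutoff for a bounded number of tracked cards\<close>

text \<open>For bounded \<open>k\<close> the distance is at most \<open>1 / 2\<close> from some multiple of \<open>n\<close> on, but it is not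
  small before an arbitrarily larger multiple of \<open>n\<close>. A window \<open>o(tmix)\<close> cannot contain both.\<close>

lemma no_cutoff_bounded:
  fixes k :: "nat \<Rightarrow> nat"
  assumes k: "\<forall>n\<ge>1. k n \<in> {1..n}" and K: "\<forall>n\<ge>1. k n < K"
  shows "\<not> has_partial_cutoff top_to_random_transposition k tmix w"
proof
  assume cutoff: "has_partial_cutoff top_to_random_transposition k tmix w"
  define d where "d \<alpha> n = max_partial_dist top_to_random_transposition n (k n) (tmix n + \<alpha> * w n)" for \<alpha> n
  have w: "w \<in> o(tmix)"
    and lim1: "((\<lambda>\<alpha>. limsup (\<lambda>n. ereal (d \<alpha> n))) \<longlongrightarrow> 0) at_top"
    and lim2: "((\<lambda>\<alpha>. liminf (\<lambda>n. ereal (d \<alpha> n))) \<longlongrightarrow> 1) at_bot"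
    using cutoff by (auto simp: has_partial_cutoff_def d_def)
  have K1: "real K \<ge> 1" using K[rule_format, of 1] by simp
  \<comment> \<open>From time \<open>2 * L * n\<close> on, the upper bound
    \<open>4 * K * exp (1 - s / (2 * n))\<close> is at most \<open>1 / 2\<close>. A distance below
    \<open>\<epsilon>\<close> with \<open>k / n \<le> \<epsilon>\<close> forces a time beyond
    \<open>D * (n - 1)\<close>. The value of \<open>D\<close> gives
    \<open>D * n / 2 > 6 * L * n\<close>, which beats the factor 3 that can separate the two
    times.\<close>
  define L where "L = 1 + ln (8 * real K)"
  define D where "D = 12 * L + 1"
  define \<epsilon> where "\<epsilon> = exp (- D) / 2"
  have L0: "L \<ge> 1" using K1 by (simp add: L_def)
  then have D0: "D > 0" by (simp add: D_def)
  have \<epsilon>0: "\<epsilon> > 0" by (simp add: \<epsilon>_def)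
  have "eventually (\<lambda>\<alpha>. limsup (\<lambda>n. ereal (d \<alpha> n)) < ereal \<epsilon>) at_top"
    using order_tendstoD(2)[OF lim1, of "ereal \<epsilon>"] \<epsilon>0 by simp
  then obtain \<alpha>1 where \<alpha>1: "limsup (\<lambda>n. ereal (d \<alpha>1 n)) < ereal \<epsilon>"
    using eventually_happens'[OF trivial_limit_at_top_linorder] by blast
  have "eventually (\<lambda>\<alpha>. ereal (1 / 2) < liminf (\<lambda>n. ereal (d \<alpha> n))) at_bot"
    using order_tendstoD(1)[OF lim2, of "ereal (1 / 2)"] by simp
  then obtain \<alpha>2 where \<alpha>2: "ereal (1 / 2) < liminf (\<lambda>n. ereal (d \<alpha>2 n))"
    using eventually_happens'[OF trivial_limit_at_bot_linorder] by blast
  \<comment> \<open>Eventually \<open>\<bar>w n\<bar> \<le> c * \<bar>tmix n\<bar>\<close>, so both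
    shifts \<open>\<alpha>1 * w n\<close> and \<open>\<alpha>2 * w n\<close> are at most half of
    \<open>\<bar>tmix n\<bar>\<close>.\<close>
  define c where "c = 1 / (2 * (1 + \<bar>\<alpha>1\<bar> + \<bar>\<alpha>2\<bar>))"
  have c0: "c > 0" by (simp add: c_def add_pos_nonneg)
  have "eventually (\<lambda>n. ereal (d \<alpha>1 n) < ereal \<epsilon>) sequentially" using \<alpha>1 by (rule Limsup_lessD)
  moreover have "eventually (\<lambda>n. ereal (1 / 2) < ereal (d \<alpha>2 n)) sequentially"
    using \<alpha>2 by (rule less_LiminfD)
  moreover have "eventually (\<lambda>n. norm (w n) \<le> c * norm (tmix n)) sequentially"
    using w c0 by (rule landau_o.smallD)
  moreover have "eventually (\<lambda>n. 8 * K + 4 + nat \<lceil>real K / \<epsilon>\<rceil> \<le> n) sequentially"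
    by (rule eventually_ge_at_top)
  ultimately have "eventually (\<lambda>n. False) sequentially"
  proof eventually_elim
    case (elim n)
    have n1: "n \<ge> 1" and n2: "real n \<ge> 2" and nK: "8 * K \<le> n" using elim by auto
    have k1: "1 \<le> k n" and kK: "k n < K" using k K n1 by auto
    have kn: "k n < n" "2 * k n + 4 \<le> n" "3 * k n \<le> n" using kK elim(4) by linarith+
    have small: "\<bar>\<alpha> * w n\<bar> \<le> \<bar>tmix n\<bar> / 2" if "\<bar>\<alpha>\<bar> \<le> 1 + \<bar>\<alpha>1\<bar> + \<bar>\<alpha>2\<bar>" for \<alpha>
    proof -
      have "\<bar>\<alpha>\<bar> * \<bar>w n\<bar> \<le> (1 + \<bar>\<alpha>1\<bar> + \<bar>\<alpha>2\<bar>) * (c * \<bar>tmix n\<bar>)"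
        using elim(3) that by (intro mult_mono) auto
      also have "\<dots> = ((1 + \<bar>\<alpha>1\<bar> + \<bar>\<alpha>2\<bar>) * c) * \<bar>tmix n\<bar>" by (simp only: mult.assoc)
      also have "(1 + \<bar>\<alpha>1\<bar> + \<bar>\<alpha>2\<bar>) * c = 1 / 2"
        using add_pos_nonneg[of 1 "\<bar>\<alpha>1\<bar> + \<bar>\<alpha>2\<bar>"] by (simp add: c_def field_simps)
      finally show ?thesis by (simp add: abs_mult)
    qed
    define s1 where "s1 = tmix n + \<alpha>1 * w n"
    define s2 where "s2 = tmix n + \<alpha>2 * w n"
    have s1: "s1 \<le> tmix n + \<bar>tmix n\<bar> / 2" using small[of \<alpha>1] unfolding s1_def by linarith
    have s2: "tmix n - \<bar>tmix n\<bar> / 2 \<le> s2" using small[of \<alpha>2] unfolding s2_def by linarith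
    have "real (k n) / real n \<le> \<epsilon>"
    proof -
      have "real K / \<epsilon> \<le> real n" using elim(4) by linarith
      then have "real K \<le> \<epsilon> * real n" using \<epsilon>0 by (simp add: field_simps)
      moreover have "real (k n) \<le> real K" using kK by simp
      ultimately have "real (k n) \<le> \<epsilon> * real n" by linarith
      then show ?thesis using n2 by (simp add: field_simps)
    qed
    moreover have "exp (- (max 0 s1 / (real n - 1))) - real (k n) / real n < \<epsilon>"
      using max_partial_dist_lower_one[OF k1 kn(1), of s1] elim(1) by (simp add: d_def s1_def)
    ultimately have "exp (- (max 0 s1 / (real n - 1))) < 2 * \<epsilon>" by linarith
    then have "exp (- (max 0 s1 / (real n - 1))) < exp (- D)" by (simp add: \<epsilon>_def)
    then have "D < max 0 s1 / (real n - 1)" by (simp only: exp_less_cancel_iff neg_less_iff_less)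
    then have "D * (real n - 1) < max 0 s1" using n2 by (simp add: pos_less_divide_eq)
    moreover have "D * (real n / 2) \<le> D * (real n - 1)" using D0 n2 by (intro mult_left_mono) auto
    moreover have "0 < D * (real n / 2)" using D0 n2 by simp
    ultimately have big: "D * (real n / 2) < s1" "0 < s1" by linarith+
    \<comment> \<open>For \<open>tmix n \<le> 0\<close> the bound on \<open>s1\<close> would be
      \<open>tmix n / 2 \<le> 0\<close>.\<close>
    have t0: "tmix n > 0" using big s1 by linarith
    have kn2: "2 * real (k n) / real n \<le> 1 / 2"
    proof -
      have "4 * k n \<le> n" using kK nK by linarith
      then have "4 * real (k n) \<le> real n" by linarith
      then show ?thesis using n2 by (simp add: field_simps)
    qed
    have s2n: "1 / 2 * (s2 / real n) \<le> (1 - 2 * real (k n) / real n) * (s2 / real n)"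
    proof (rule mult_right_mono)
      show "1 / 2 \<le> 1 - 2 * real (k n) / real n" using kn2 by linarith
      have "0 \<le> s2" using s2 t0 by linarith
      then show "0 \<le> s2 / real n" by simp
    qed
    have "1 / 2 < 4 * real (k n) * exp (1 - (1 - 2 * real (k n) / real n) * (s2 / real n))"
    proof -
      have "1 / 2 < d \<alpha>2 n" using elim(2) by simp
      then show ?thesis
        using max_partial_dist_upper_exp[OF k1 kn(2,3), of s2] unfolding d_def s2_def by linarith
    qed
    also have "\<dots> \<le> 4 * real K * exp (1 - 1 / 2 * (s2 / real n))"
    proof (rule mult_mono)
      show "exp (1 - (1 - 2 * real (k n) / real n) * (s2 / real n)) \<le> exp (1 - 1 / 2 * (s2 / real n))"
        unfolding exp_le_cancel_iff using s2n by linarith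
    qed (use kK in auto)
    finally have "1 < 8 * real K * exp (1 - 1 / 2 * (s2 / real n))" by simp
    also have "8 * real K = exp (ln (8 * real K))" using K1 by simp
    finally have "exp 0 < exp (ln (8 * real K) + (1 - 1 / 2 * (s2 / real n)))"
      by (simp only: exp_add exp_zero)
    then have "1 / 2 * (s2 / real n) < L" unfolding exp_less_cancel_iff L_def by linarith
    then have "s2 < 2 * (L * real n)" using n2 by (simp add: field_simps)
    \<comment> \<open>\<open>s1 \<le> 3 / 2 * tmix n\<close> and \<open>tmix n \<le> 2 * s2\<close>
      combine to \<open>s1 \<le> 3 * s2\<close>.\<close>
    then have "s1 < 6 * (L * real n)" using s1 s2 t0 by linarith
    moreover have "D * (real n / 2) = 6 * (L * real n) + real n / 2" by (simp add: D_def field_simps)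
    ultimately show False using big n2 by linarith
  qed
  then show False by simp
qed

theorem theorem3:
  fixes k :: "nat \<Rightarrow> nat"
  assumes "\<forall>n\<ge>1. k n \<in> {1..n}"
  shows "((\<lambda>n. real (k n)) \<in> o(\<lambda>n. sqrt (real n / ln (real n))) \<and>
            filterlim k at_top sequentially \<longrightarrow>
          (\<exists>w. w \<in> O(\<lambda>n. real n) \<and>
             has_partial_cutoff top_to_random_transposition k (\<lambda>n. real n * ln (real (k n))) w)) \<and>
         ((\<exists>K. \<forall>n\<ge>1. k n < K) \<longrightarrow>
          \<not> (\<exists>tmix w. has_partial_cutoff top_to_random_transposition k tmix w))"
proof (intro conjI impI)
  assume "(\<lambda>n. real (k n)) \<in> o(\<lambda>n. sqrt (real n / ln (real n))) \<and> filterlim k at_top sequentially"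
  then have "has_partial_cutoff top_to_random_transposition k (\<lambda>n. real n * ln (real (k n))) real"
    using cutoff_unbounded[OF assms] by blast
  moreover have "real \<in> O(\<lambda>n. real n)" by simp
  ultimately show "\<exists>w. w \<in> O(\<lambda>n. real n) \<and>
      has_partial_cutoff top_to_random_transposition k (\<lambda>n. real n * ln (real (k n))) w"
    by blast
next
  assume "\<exists>K. \<forall>n\<ge>1. k n < K"
  then show "\<not> (\<exists>tmix w. has_partial_cutoff top_to_random_transposition k tmix w)"
    using no_cutoff_bounded[OF assms] by blast
qed

end
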